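(* Let $A$ be a Banach algebra and $B$ a left Banach $A$-module. Consider the following statements. (1) $B^*A\subseteq wap_\ell(B)$. (2) $AA^{**}\subseteq Z_{B^{**}}(A^{**})$. (3) $AA^{**}\subseteq A\,Z_{B^{**}}((A^*A)^* )$. Then (1) and (2) are equivalent, and (3) implies (2); that is, $(1)\Leftrightarrow(2)\Leftarrow(3)$.
   Context: For a bounded bilinear map $m:X\times Y\to Z$ of normed spaces, define $m^*:Z^*\times X\to Y^*$ by $\langle m^*(z',x),y\rangle=\langle z',m(x,y)\rangle$, and $m^{**}=(m^* )^*:Y^{**}\times Z^*\to X^*$, $m^{***}=(m^{**})^*:X^{**}\times Y^{**}\to Z^{**}$, so $\langle m^{**}(y'',z'),x\rangle=\langle y'',m^*(z',x)\rangle$ and $\langle m^{***}(x'',y''),z'\rangle=\langle x'',m^{**}(y'',z')\rangle$. Let $\pi_\ell:A\times B\to B$ be the module action. $Z_{B^{**}}(A^{**})=\{a''\in A^{**}: b''\mapsto\pi_\ell^{***}(a'',b'')\text{ is weak}^*\text{-to-weak}^*\text{ continuous on }B^{**}\}$. $B^*$ is a right $A$-module via $b'a=\pi_\ell^*(b',a)$, i.e. $\langle b'a,b\rangle=\langle b',ab\rangle$; $B^*A=\{b'a:b'\in B^*,a\in A\}$. For $a'\in A^*$ and $a\in A$, $a'a\in A^*$ is given by $\langle a'a,c\rangle=\langle a',ac\rangle$ ($c\in A$), and $A^*A=\{a'a:a'\in A^*,a\in A\}$; $(A^*A)^*$ denotes the dual of the closed linear span of $A^*A$ in $A^*$. $AA^{**}=\{aa'':a\in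 A,a''\in A^{**}\}$, where $\langle aa'',a'\rangle=\langle a'',a'a\rangle$ for $a'\in A^*$ (the Arens product of $a\in A\subseteq A^{**}$ and $a''$). Likewise, for $a\in A$ and $F\in(A^*A)^*$, $aF\in A^{**}$ is given by $\langle aF,a'\rangle=\langle F,a'a\rangle$, and $A\,Z_{B^{**}}((A^*A)^* )=\{aF:a\in A,\ F\in Z_{B^{**}}((A^*A)^* )\}$. $Z_{B^{**}}((A^*A)^* )$ is the set of $F\in(A^*A)^*$ such that $b''\mapsto\pi_\ell^{***}(F,b'')$ is weak$^*$-to-weak$^*$ continuous on $B^{**}$, where $\langle\pi_\ell^{***}(F,b''),b'\rangle=\langle F,\pi_\ell^{**}(b'',b')\rangle$ for $b'\in B^*A$ (for $b'=x'a$ with $x'\in B^*$, $a\in A$, one has $\pi_\ell^{**}(b'',x'a)=\pi_\ell^{**}(b'',x')a\in A^*A$); that is, $b''\mapsto\langle F,\pi_\ell^{**}(b'',b')\rangle$ is weak$^*$ continuous on $B^{**}$ for every $b'\in B^*A$. $wap_\ell(B)$ is the set of $b'\in B^*$ such that $\{\pi_\ell^*(b',a):a\in A,\|a\|\le1\}$ is relatively weakly compact in $B^*$. *)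

theory Defs
  imports "HOL-Analysis.Analysis"
begin

section \<open>Normed spaces, Banach algebras and Banach modules over \<open>\<real>\<close> or \<open>\<complex>\<close>\<close>

text \<open>
  The scalar field is a type \<open>'k\<close> of sort \<open>{real_normed_field, euclidean_space}\<close>: both
  \<^typ>\<open>real\<close> and \<^typ>\<open>complex\<close> have this sort, and by the Gelfand-Mazur theorem there are no
  other instances up to isometric isomorphism. The scalar multiplication is an explicit
  parameter, compatible with the real one of the type class.
\<close>

locale normed_space = vector_space scaleV
  for scaleV :: "'k::{real_normed_field, euclidean_space} \<Rightarrow> 'v::real_normed_vector \<Rightarrow> 'v" +
  assumes scale_of_real: "scaleV (of_real r) x = r *\<^sub>R x"
    and norm_scale: "norm (scaleV c x) = norm c * norm x"

locale banach_algebra = normed_space scaleA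
  for scaleA :: "'k::{real_normed_field, euclidean_space} \<Rightarrow> 'a::{real_normed_algebra, banach} \<Rightarrow> 'a" +
  assumes mult_scale_left: "scaleA c x * y = scaleA c (x * y)"
    and mult_scale_right: "x * scaleA c y = scaleA c (x * y)"

locale left_banach_module = A: banach_algebra scaleA + B: normed_space scaleB
  for scaleA :: "'k::{real_normed_field, euclidean_space} \<Rightarrow> 'a::{real_normed_algebra, banach} \<Rightarrow> 'a"
    and scaleB :: "'k \<Rightarrow> 'b::banach \<Rightarrow> 'b" +
  fixes act :: "'a \<Rightarrow> 'b \<Rightarrow> 'b"
  assumes bounded_bilinear_act: "bounded_bilinear act"
    and act_scale_left: "act (scaleA c a) b = scaleB c (act a b)"
    and act_scale_right: "act a (scaleB c b) = scaleB c (act a b)"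
    and act_mult: "act (a * a') b = act a (act a' b)"


section \<open>Duals and their topologies\<close>

text \<open>
  The dual \<open>V\<^sup>*\<close>: the \<open>'k\<close>-homogeneous elements of \<open>'v \<Rightarrow>\<^sub>L 'k\<close>, with the norm of that type. The
  set is norm closed, so closures in the type of subsets of \<open>V\<^sup>*\<close> are closures in \<open>V\<^sup>*\<close>.
\<close>

definition dual ::
    "('k::{real_normed_field, euclidean_space} \<Rightarrow> 'v::real_normed_vector \<Rightarrow> 'v) \<Rightarrow> ('v \<Rightarrow>\<^sub>L 'k) set"
  where "dual scaleV = {f :: 'v \<Rightarrow>\<^sub>L 'k. \<forall>c x. f (scaleV c x) = c * f x}"

definition scale_dual ::
    "'k::{real_normed_field, euclidean_space} \<Rightarrow> ('v::real_normed_vector \<Rightarrow>\<^sub>L 'k) \<Rightarrow> ('v \<Rightarrow>\<^sub>L 'k)"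
  where "scale_dual c f = blinfun_mult_right c o\<^sub>L f"

text \<open>
  The dual of a linear subspace \<open>V\<close> of a normed space. A functional on \<open>V\<close> is represented by the
  function that agrees with it on \<open>V\<close> and is \<^const>\<open>undefined\<close> elsewhere.
\<close>

definition dual_on ::
    "('k::{real_normed_field, euclidean_space} \<Rightarrow> 'v::real_normed_vector \<Rightarrow> 'v) \<Rightarrow> 'v set \<Rightarrow> ('v \<Rightarrow> 'k) set"
  where "dual_on scaleV V = {F \<in> extensional V.
    (\<forall>x\<in>V. \<forall>y\<in>V. F (x + y) = F x + F y) \<and>
    (\<forall>c. \<forall>x\<in>V. F (scaleV c x) = c * F x) \<and>
    (\<exists>M. \<forall>x\<in>V. norm (F x) \<le> M * norm x)}"

definition bidual ::
    "('k::{real_normed_field, euclidean_space} \<Rightarrow> 'v::real_normed_vector \<Rightarrow> 'v) \<Rightarrow> (('v \<Rightarrow>\<^sub>L 'k) \<Rightarrow> 'k) set"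
  where "bidual scaleV = dual_on scale_dual (dual scaleV)"

text \<open>The weak* topology \<open>\<sigma>(V\<^sup>*\<^sup>*, V\<^sup>*)\<close>, i.e. pointwise convergence on \<open>V\<^sup>*\<close>.\<close>

definition weak_star_bidual ::
    "('k::{real_normed_field, euclidean_space} \<Rightarrow> 'v::real_normed_vector \<Rightarrow> 'v) \<Rightarrow> (('v \<Rightarrow>\<^sub>L 'k) \<Rightarrow> 'k) topology"
  where "weak_star_bidual scaleV =
    subtopology (product_topology (\<lambda>_. euclidean) (dual scaleV)) (bidual scaleV)"

text \<open>The weak topology \<open>\<sigma>(V\<^sup>*, V\<^sup>*\<^sup>*)\<close>.\<close>

definition weak_dual ::
    "('k::{real_normed_field, euclidean_space} \<Rightarrow> 'v::real_normed_vector \<Rightarrow> 'v) \<Rightarrow> ('v \<Rightarrow>\<^sub>L 'k) topology"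
  where "weak_dual scaleV =
    topology_generated_by {{f \<in> dual scaleV. F f \<in> U} | F U. F \<in> bidual scaleV \<and> open U}"

definition relatively_compactin :: "'x topology \<Rightarrow> 'x set \<Rightarrow> bool"
  where "relatively_compactin T S \<longleftrightarrow> S \<subseteq> topspace T \<and> compactin T (T closure_of S)"


section \<open>Adjoints of bilinear maps\<close>

text \<open>
  For a bounded bilinear \<open>m : X \<times> Y \<rightarrow> Z\<close> these are \<open>m\<^sup>* : Z\<^sup>* \<times> X \<rightarrow> Y\<^sup>*\<close>, \<open>m\<^sup>*\<^sup>* : Y\<^sup>*\<^sup>* \<times> Z\<^sup>* \<rightarrow> X\<^sup>*\<close>
  and \<open>m\<^sup>*\<^sup>*\<^sup>* : X\<^sup>*\<^sup>* \<times> Y\<^sup>*\<^sup>* \<rightarrow> Z\<^sup>*\<^sup>*\<close>; on these domains the functions to which \<^const>\<open>Blinfun\<close> is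
  applied are bounded linear. The parameter \<open>scaleZ\<close> only serves to name \<open>Z\<^sup>*\<close>, the domain of
  the functional \<open>m\<^sup>*\<^sup>*\<^sup>*(x'', y'')\<close>.
\<close>

definition adj1 ::
    "('x::real_normed_vector \<Rightarrow> 'y::real_normed_vector \<Rightarrow> 'z::real_normed_vector) \<Rightarrow>
     ('z \<Rightarrow>\<^sub>L 'k::{real_normed_field, euclidean_space}) \<Rightarrow> 'x \<Rightarrow> ('y \<Rightarrow>\<^sub>L 'k)"
  where "adj1 m z' x = Blinfun (\<lambda>y. z' (m x y))"

definition adj2 ::
    "('x::real_normed_vector \<Rightarrow> 'y::real_normed_vector \<Rightarrow> 'z::real_normed_vector) \<Rightarrow>
     (('y \<Rightarrow>\<^sub>L 'k::{real_normed_field, euclidean_space}) \<Rightarrow> 'k) \<Rightarrow> ('z \<Rightarrow>\<^sub>L 'k) \<Rightarrow> ('x \<Rightarrow>\<^sub>L 'k)"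
  where "adj2 m y'' z' = Blinfun (\<lambda>x. y'' (adj1 m z' x))"

definition adj3 ::
    "('k::{real_normed_field, euclidean_space} \<Rightarrow> 'z::real_normed_vector \<Rightarrow> 'z) \<Rightarrow>
     ('x::real_normed_vector \<Rightarrow> 'y::real_normed_vector \<Rightarrow> 'z) \<Rightarrow>
     (('x \<Rightarrow>\<^sub>L 'k) \<Rightarrow> 'k) \<Rightarrow> (('y \<Rightarrow>\<^sub>L 'k) \<Rightarrow> 'k) \<Rightarrow> (('z \<Rightarrow>\<^sub>L 'k) \<Rightarrow> 'k)"
  where "adj3 scaleZ m x'' y'' = (\<lambda>z'\<in>dual scaleZ. x'' (adj2 m y'' z'))"


section \<open>The sets in the theorem\<close>

text \<open>\<open>Z\<^bsub>B\<^sup>*\<^sup>*\<^esub>(A\<^sup>*\<^sup>*)\<close>\<close>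

definition top_center ::
    "('k::{real_normed_field, euclidean_space} \<Rightarrow> 'a::{real_normed_algebra, banach} \<Rightarrow> 'a) \<Rightarrow>
     ('k \<Rightarrow> 'b::banach \<Rightarrow> 'b) \<Rightarrow> ('a \<Rightarrow> 'b \<Rightarrow> 'b) \<Rightarrow> (('a \<Rightarrow>\<^sub>L 'k) \<Rightarrow> 'k) set"
  where "top_center scaleA scaleB act = {a'' \<in> bidual scaleA.
    continuous_map (weak_star_bidual scaleB) (weak_star_bidual scaleB)
      (\<lambda>b''. adj3 scaleB act a'' b'')}"

text \<open>
  \<open>V\<^sup>*A\<close> for a bounded bilinear \<open>A \<times> V \<rightarrow> V\<close>: this is \<open>B\<^sup>*A\<close> for the module action and \<open>A\<^sup>*A\<close> for
  the multiplication of \<open>A\<close>, since \<open>a'a = m\<^sup>*(a', a)\<close> for the latter.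
\<close>

definition dual_times ::
    "('k::{real_normed_field, euclidean_space} \<Rightarrow> 'v::real_normed_vector \<Rightarrow> 'v) \<Rightarrow>
     ('a::real_normed_vector \<Rightarrow> 'v \<Rightarrow> 'v) \<Rightarrow> ('v \<Rightarrow>\<^sub>L 'k) set"
  where "dual_times scaleV m = {adj1 m v' a | v' a. v' \<in> dual scaleV}"

text \<open>The closed linear span of \<open>A\<^sup>*A\<close> in \<open>A\<^sup>*\<close>.\<close>

definition AstarA ::
    "('k::{real_normed_field, euclidean_space} \<Rightarrow> 'a::{real_normed_algebra, banach} \<Rightarrow> 'a) \<Rightarrow> ('a \<Rightarrow>\<^sub>L 'k) set"
  where "AstarA scaleA = closure (module.span scale_dual (dual_times scaleA (*)))"

text \<open>
  \<open>aF \<in> A\<^sup>*\<^sup>*\<close> with \<open>\<langle>aF, a'\<rangle> = \<langle>F, a'a\<rangle>\<close>, both for \<open>F \<in> A\<^sup>*\<^sup>*\<close> and for \<open>F \<in> (A\<^sup>*A)\<^sup>*\<close>.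
\<close>

definition left_mult ::
    "('k::{real_normed_field, euclidean_space} \<Rightarrow> 'a::{real_normed_algebra, banach} \<Rightarrow> 'a) \<Rightarrow>
     'a \<Rightarrow> (('a \<Rightarrow>\<^sub>L 'k) \<Rightarrow> 'k) \<Rightarrow> (('a \<Rightarrow>\<^sub>L 'k) \<Rightarrow> 'k)"
  where "left_mult scaleA a F = (\<lambda>a'\<in>dual scaleA. F (adj1 (*) a' a))"

definition left_mult_set ::
    "('k::{real_normed_field, euclidean_space} \<Rightarrow> 'a::{real_normed_algebra, banach} \<Rightarrow> 'a) \<Rightarrow>
     (('a \<Rightarrow>\<^sub>L 'k) \<Rightarrow> 'k) set \<Rightarrow> (('a \<Rightarrow>\<^sub>L 'k) \<Rightarrow> 'k) set"
  where "left_mult_set scaleA S = {left_mult scaleA a F | a F. F \<in> S}"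

text \<open>
  \<open>Z\<^bsub>B\<^sup>*\<^sup>*\<^esub>((A\<^sup>*A)\<^sup>*)\<close>. Here \<open>\<pi>\<^sup>*\<^sup>*\<^sup>*(F, b'')\<close> is only defined on \<open>B\<^sup>*A\<close>, so weak* continuity is
  continuity of its values at the points of \<open>B\<^sup>*A\<close>.
\<close>

definition top_center_AstarA ::
    "('k::{real_normed_field, euclidean_space} \<Rightarrow> 'a::{real_normed_algebra, banach} \<Rightarrow> 'a) \<Rightarrow>
     ('k \<Rightarrow> 'b::banach \<Rightarrow> 'b) \<Rightarrow> ('a \<Rightarrow> 'b \<Rightarrow> 'b) \<Rightarrow> (('a \<Rightarrow>\<^sub>L 'k) \<Rightarrow> 'k) set"
  where "top_center_AstarA scaleA scaleB act = {F \<in> dual_on scale_dual (AstarA scaleA).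
    \<forall>b' \<in> dual_times scaleB act.
      continuous_map (weak_star_bidual scaleB) euclidean (\<lambda>b''. F (adj2 act b'' b'))}"

definition wap_l ::
    "('k::{real_normed_field, euclidean_space} \<Rightarrow> 'b::banach \<Rightarrow> 'b) \<Rightarrow>
     ('a::{real_normed_algebra, banach} \<Rightarrow> 'b \<Rightarrow> 'b) \<Rightarrow> ('b \<Rightarrow>\<^sub>L 'k) set"
  where "wap_l scaleB act = {b' \<in> dual scaleB.
    relatively_compactin (weak_dual scaleB) {adj1 act b' a | a. norm a \<le> 1}}"

end

theory Submission
  imports Defs
begin

text \<open>
  Write \<open>T\<^sub>f : A \<rightarrow> B\<^sup>*\<close>, \<open>a \<mapsto> fa\<close>, for the orbit map of \<open>f \<in> B\<^sup>*\<close>. Then \<open>f \<in> wap\<^sub>\<ell>(B)\<close> says that \<open>T\<^sub>f\<close>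
  is a weakly compact operator, and \<open>\<pi>\<^sub>\<ell>\<^sup>*\<^sup>*(G, f)\<close> is the adjoint of \<open>T\<^sub>f\<close> applied to \<open>G \<in> B\<^sup>*\<^sup>*\<close>.
  By Gantmacher's theorem, \<open>T\<^sub>f\<close> is weakly compact iff its second adjoint maps \<open>A\<^sup>*\<^sup>*\<close> into the
  canonical image of \<open>B\<^sup>*\<close>, that is, iff \<open>G \<mapsto> F(\<pi>\<^sub>\<ell>\<^sup>*\<^sup>*(G, f))\<close> is weak* continuous for every
  \<open>F \<in> A\<^sup>*\<^sup>*\<close> (lemma \<open>wap_l_iff\<close>).

  On the other side, associativity of the action gives \<open>\<pi>\<^sub>\<ell>\<^sup>*\<^sup>*(G, f)a = \<pi>\<^sub>\<ell>\<^sup>*\<^sup>*(G, fa)\<close> (lemma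
  \<open>adj1_adj2\<close>), so that \<open>\<langle>\<pi>\<^sub>\<ell>\<^sup>*\<^sup>*\<^sup>*(aF, G), f\<rangle> = F(\<pi>\<^sub>\<ell>\<^sup>*\<^sup>*(G, fa))\<close>: membership of \<open>aF\<close> in the
  topological centre tests \<open>F\<close> only against the elements \<open>fa\<close> of \<open>B\<^sup>*A\<close>. Quantified over all \<open>F\<close>, \<open>f\<close>
  and \<open>a\<close> this is the condition of the previous paragraph for all elements of \<open>B\<^sup>*A\<close>, which is
  the claimed equivalence. The same formula holds for \<open>F \<in> (A\<^sup>*A)\<^sup>*\<close>, where the centre is
  defined by exactly these continuity conditions; hence an element of \<open>A\<^sup>*\<^sup>*\<close> of the form \<open>aF\<close> with
  \<open>F\<close> in that centre lies in \<open>Z\<^bsub>B\<^sup>*\<^sup>*\<^esub>(A\<^sup>*\<^sup>*)\<close>, which is the claimed implication.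

  Gantmacher's theorem rests on three facts: weak* continuous
  functionals on a bidual are evaluations, the unit ball of a bidual is weak* compact
  (Banach-Alaoglu), and the unit ball of a space is weak* dense in that of its bidual
  (Goldstine).
\<close>

section \<open>Duals and biduals\<close>

lemma scale_dual_apply [simp]: "scale_dual c f x = c * f x"
  by (simp add: scale_dual_def)

lemma scale_dual_of_real: "scale_dual (of_real r) f = r *\<^sub>R f"
  by (rule blinfun_eqI) (simp add: scaleR_conv_of_real blinfun.scaleR_left)

lemma dualD: "f \<in> dual scaleV \<Longrightarrow> f (scaleV c x) = c * f x"
  by (simp add: dual_def)

lemma dual_zero: "0 \<in> dual scaleV"
  by (simp add: dual_def)

lemma dual_add: "f \<in> dual scaleV \<Longrightarrow> g \<in> dual scaleV \<Longrightarrow> f + g \<in> dual scaleV"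
  by (simp add: dual_def blinfun.add_left algebra_simps)

lemma dual_scale: "f \<in> dual scaleV \<Longrightarrow> scale_dual c f \<in> dual scaleV"
  by (simp add: dual_def)

lemma dual_sum: "(\<And>i. i \<in> I \<Longrightarrow> f i \<in> dual scaleV) \<Longrightarrow> (\<Sum>i\<in>I. f i) \<in> dual scaleV"
  by (induction I rule: infinite_finite_induct) (auto intro: dual_zero dual_add)

lemma bidual_add:
  "F \<in> bidual scaleV \<Longrightarrow> f \<in> dual scaleV \<Longrightarrow> g \<in> dual scaleV \<Longrightarrow> F (f + g) = F f + F g"
  by (simp add: bidual_def dual_on_def)

lemma bidual_scale: "F \<in> bidual scaleV \<Longrightarrow> f \<in> dual scaleV \<Longrightarrow> F (scale_dual c f) = c * F f"
  by (simp add: bidual_def dual_on_def)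

lemma bidual_scaleR: "F \<in> bidual scaleV \<Longrightarrow> f \<in> dual scaleV \<Longrightarrow> F (r *\<^sub>R f) = r *\<^sub>R F f"
  using bidual_scale[of F scaleV f "of_real r"] by (simp add: scale_dual_of_real scaleR_conv_of_real)

lemma bidual_zero: "F \<in> bidual scaleV \<Longrightarrow> F 0 = 0"
  using bidual_scaleR[of F scaleV 0 0] by (simp add: dual_zero)

lemma bidual_sum:
  assumes "F \<in> bidual scaleV" "\<And>i. i \<in> I \<Longrightarrow> f i \<in> dual scaleV"
  shows "F (\<Sum>i\<in>I. f i) = (\<Sum>i\<in>I. F (f i))"
  using assms(2)
  by (induction I rule: infinite_finite_induct)
    (auto simp: bidual_zero[OF assms(1)] bidual_add[OF assms(1)] dual_sum)

lemma bidual_extensional: "F \<in> bidual scaleV \<Longrightarrow> F \<in> extensional (dual scaleV)"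
  by (simp add: bidual_def dual_on_def)

lemma bidual_bound:
  assumes "F \<in> bidual scaleV"
  obtains M where "M > 0" "\<And>f. f \<in> dual scaleV \<Longrightarrow> norm (F f) \<le> M * norm f"
proof -
  from assms obtain M where M: "\<And>f. f \<in> dual scaleV \<Longrightarrow> norm (F f) \<le> M * norm f"
    unfolding bidual_def dual_on_def by blast
  show ?thesis
  proof (rule that[of "max M 1"])
    fix f assume "f \<in> dual scaleV"
    from M[OF this] show "norm (F f) \<le> max M 1 * norm f"
      by (rule order_trans) (simp add: mult_right_mono)
  qed simp
qed

lemma bidualI:
  fixes scaleV :: "'k::{real_normed_field, euclidean_space} \<Rightarrow> 'v::real_normed_vector \<Rightarrow> 'v"
  assumes "F \<in> extensional (dual scaleV)"
    and lin: "\<And>f g c. f \<in> dual scaleV \<Longrightarrow> g \<in> dual scaleV \<Longrightarrow> F (f + scale_dual c g) = F f + c * F g"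
    and "\<And>f. f \<in> dual scaleV \<Longrightarrow> norm (F f) \<le> M * norm f"
  shows "F \<in> bidual scaleV"
proof -
  have one: "scale_dual 1 g = g" for g :: "'v \<Rightarrow>\<^sub>L 'k"
    by (rule blinfun_eqI) simp
  have "F 0 = 0"
    using lin[OF dual_zero dual_zero, of 1] by (simp add: one)
  then show ?thesis
    using assms(1) lin[of _ _ 1] lin[OF dual_zero]
    unfolding bidual_def dual_on_def by (auto simp: one intro!: exI[of _ M] assms(3))
qed

lemma bidual_linear_comb:
  assumes "F \<in> bidual scaleV" "G \<in> bidual scaleV"
  shows "(\<lambda>f\<in>dual scaleV. F f + c * G f) \<in> bidual scaleV"
proof -
  obtain M N where M: "\<And>f. f \<in> dual scaleV \<Longrightarrow> norm (F f) \<le> M * norm f"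
    and N: "\<And>f. f \<in> dual scaleV \<Longrightarrow> norm (G f) \<le> N * norm f"
    using bidual_bound[OF assms(1)] bidual_bound[OF assms(2)] by metis
  show ?thesis
  proof (rule bidualI[where M = "M + norm c * N"])
    fix f assume f: "f \<in> dual scaleV"
    have "norm (F f + c * G f) \<le> norm (F f) + norm c * norm (G f)"
      by (metis norm_triangle_ineq norm_mult)
    also have "\<dots> \<le> M * norm f + norm c * (N * norm f)"
      by (intro add_mono mult_left_mono M N f) simp
    finally show "norm ((\<lambda>f\<in>dual scaleV. F f + c * G f) f) \<le> (M + norm c * N) * norm f"
      using f by (simp add: algebra_simps)
  qed (auto simp: dual_add dual_scale bidual_add[OF assms(1)] bidual_add[OF assms(2)]
      bidual_scale[OF assms(1)] bidual_scale[OF assms(2)] algebra_simps)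
qed

lemma bidual_evaluation: "(\<lambda>f\<in>dual scaleV. blinfun_apply f x) \<in> bidual scaleV"
proof (rule bidualI[where M = "norm x"])
  fix f assume "f \<in> dual scaleV"
  then show "norm ((\<lambda>f\<in>dual scaleV. blinfun_apply f x) f) \<le> norm x * norm f"
    using norm_blinfun[of f x] by (simp add: mult.commute)
qed (auto simp: dual_add dual_scale blinfun.add_left)

lemma topspace_weak_star_bidual: "topspace (weak_star_bidual scaleV) = bidual scaleV"
  by (auto simp: weak_star_bidual_def PiE_def dest: bidual_extensional)

lemma topspace_weak_dual: "topspace (weak_dual scaleV) = dual scaleV"
  using bidual_evaluation[where scaleV = scaleV and x = 0]
  unfolding weak_dual_def topology_generated_by_topspace
  by (auto intro!: exI[of _ UNIV])

lemma continuous_map_weak_star_evaluation: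
  assumes "f \<in> dual scaleV"
  shows "continuous_map (weak_star_bidual scaleV) euclidean (\<lambda>F. F f)"
  unfolding weak_star_bidual_def using assms
  by (intro continuous_map_from_subtopology continuous_map_product_projection)

lemma continuous_map_weak_functional:
  assumes "F \<in> bidual scaleV"
  shows "continuous_map (weak_dual scaleV) euclidean F"
proof -
  have "openin (weak_dual scaleV) {f \<in> dual scaleV. F f \<in> U}" if "open U" for U
    unfolding weak_dual_def using that assms by (intro topology_generated_by_Basis) blast
  then show ?thesis
    by (simp add: continuous_map_def topspace_weak_dual)
qed

lemma continuous_map_mult_const:
  fixes f :: "'x \<Rightarrow> 'k::real_normed_algebra"
  assumes "continuous_map X euclidean f"
  shows "continuous_map X euclidean (\<lambda>x. c * f x)"
proof -
  have "continuous_map euclidean euclidean (\<lambda>y. c * y)"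
    by (auto intro!: continuous_intros)
  from continuous_map_compose[OF assms this] show ?thesis
    by (simp add: o_def)
qed

lemma Hausdorff_weak_dual:
  fixes scaleV :: "'k::{real_normed_field, euclidean_space} \<Rightarrow> 'v::real_normed_vector \<Rightarrow> 'v"
  shows "Hausdorff_space (weak_dual scaleV)"
  unfolding Hausdorff_space_def topspace_weak_dual
proof (intro allI impI, elim conjE)
  fix f g :: "'v \<Rightarrow>\<^sub>L 'k" assume fg: "f \<in> dual scaleV" "g \<in> dual scaleV" "f \<noteq> g"
  then obtain x where "f x \<noteq> g x"
    by (meson blinfun_eqI)
  then obtain U V where UV: "open U" "open V" "f x \<in> U" "g x \<in> V" "U \<inter> V = {}"
    using hausdorff[of "f x" "g x"] by blast
  have "openin (weak_dual scaleV) {h \<in> dual scaleV. h x \<in> W}" if "open W" for W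
    using openin_continuous_map_preimage[OF
        continuous_map_weak_functional[OF bidual_evaluation[where scaleV = scaleV and x = x]], of W] that
    by (simp add: topspace_weak_dual cong: conj_cong)
  then show "\<exists>U V. openin (weak_dual scaleV) U \<and> openin (weak_dual scaleV) V \<and> f \<in> U \<and> g \<in> V \<and> disjnt U V"
    using UV fg
    by (intro exI[of _ "{h \<in> dual scaleV. h x \<in> U}"] exI[of _ "{h \<in> dual scaleV. h x \<in> V}"])
      (auto simp: disjnt_def)
qed


section \<open>Weak* continuous functionals on a bidual\<close>

text \<open>
  A functional that vanishes on the common kernel of finitely many coordinates is a linear
  combination of these coordinates: induct on their number, restricting \<open>\<phi>\<close> to the kernel of
  one coordinate and correcting by a multiple of that coordinate. Since the induction passes
  to the kernel, the space \<open>V\<close> must stay arbitrary. Its linear structure is the one of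
  extensional functions on \<open>D\<close>, as in a bidual.
\<close>

lemma functional_on_finite_kernel:
  fixes V :: "('i \<Rightarrow> 'k::field) set"
  assumes "finite J" "J \<subseteq> D"
    and "\<And>x y c. x \<in> V \<Longrightarrow> y \<in> V \<Longrightarrow> (\<lambda>i\<in>D. x i + c * y i) \<in> V"
    and "\<And>x y c. x \<in> V \<Longrightarrow> y \<in> V \<Longrightarrow> \<phi> (\<lambda>i\<in>D. x i + c * y i) = \<phi> x + c * \<phi> y"
    and "\<And>x. x \<in> V \<Longrightarrow> (\<And>j. j \<in> J \<Longrightarrow> x j = 0) \<Longrightarrow> \<phi> x = 0"
  shows "\<exists>c. \<forall>x\<in>V. \<phi> x = (\<Sum>j\<in>J. c j * x j)"
  using assms
proof (induction J arbitrary: V rule: finite_induct)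
  case empty
  then show ?case by simp
next
  case (insert k J)
  note kD = \<open>insert k J \<subseteq> D\<close>
  let ?W = "{x \<in> V. x k = 0}"
  have "\<exists>c. \<forall>x\<in>?W. \<phi> x = (\<Sum>j\<in>J. c j * x j)"
  proof (rule insert.IH)
    show "\<phi> x = 0" if "x \<in> ?W" "\<And>j. j \<in> J \<Longrightarrow> x j = 0" for x
      using that by (intro insert.prems(4)) auto
  qed (use insert.prems(1-3) in auto)
  then obtain c where c: "\<And>x. x \<in> V \<Longrightarrow> x k = 0 \<Longrightarrow> \<phi> x = (\<Sum>j\<in>J. c j * x j)"
    by blast
  show ?case
  proof (cases "\<exists>e\<in>V. e k \<noteq> 0")
    case False
    then show ?thesis
      using c insert.hyps by (intro exI[of _ c]) auto
  next
    case True
    then obtain e where e: "e \<in> V" "e k \<noteq> 0" by blast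
    define d where "d = (\<phi> e - (\<Sum>j\<in>J. c j * e j)) / e k"
    have "\<phi> x = d * x k + (\<Sum>j\<in>J. c j * x j)" if x: "x \<in> V" for x
    proof -
      define t where "t = - (x k / e k)"
      let ?y = "\<lambda>i\<in>D. x i + t * e i"
      have "?y \<in> V"
        by (rule insert.prems(2)[OF x e(1)])
      moreover have "?y k = 0"
        using e(2) kD by (simp add: t_def)
      ultimately have "\<phi> ?y = (\<Sum>j\<in>J. c j * ?y j)"
        by (rule c)
      also have "\<dots> = (\<Sum>j\<in>J. c j * x j + t * (c j * e j))"
        using kD by (intro sum.cong) (auto simp: algebra_simps)
      also have "\<dots> = (\<Sum>j\<in>J. c j * x j) + t * (\<Sum>j\<in>J. c j * e j)"
        by (simp add: sum.distrib sum_distrib_left)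
      finally have "\<phi> x = (\<Sum>j\<in>J. c j * x j) + t * ((\<Sum>j\<in>J. c j * e j) - \<phi> e)"
        using insert.prems(3)[OF x e(1)] by (simp add: algebra_simps)
      then show ?thesis
        using e(2) by (simp add: t_def d_def field_simps)
    qed
    then have "\<forall>x\<in>V. \<phi> x = (\<Sum>j\<in>insert k J. (c(k := d)) j * x j)"
      using insert.hyps by (auto intro!: sum.cong)
    then show ?thesis by blast
  qed
qed

text \<open>
  A basic weak* neighbourhood of \<open>0\<close> on which \<open>|\<phi>| < 1\<close> constrains only finitely many
  coordinates. It contains the whole common kernel of these, a linear space, so \<open>\<phi>\<close> vanishes
  there and is a combination of evaluations.
\<close>

lemma weak_star_continuous_imp_evaluation:
  fixes scaleV :: "'k::{real_normed_field, euclidean_space} \<Rightarrow> 'v::real_normed_vector \<Rightarrow> 'v"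
  assumes cont: "continuous_map (weak_star_bidual scaleV) euclidean \<phi>"
    and lin: "\<And>F G c. F \<in> bidual scaleV \<Longrightarrow> G \<in> bidual scaleV \<Longrightarrow>
      \<phi> (\<lambda>f\<in>dual scaleV. F f + c * G f) = \<phi> F + c * \<phi> G"
  shows "\<exists>g\<in>dual scaleV. \<forall>F\<in>bidual scaleV. \<phi> F = F g"
proof -
  let ?D = "dual scaleV" and ?O = "\<lambda>f\<in>dual scaleV. (0 :: 'k)"
  have O: "?O \<in> bidual scaleV"
    by (rule bidualI[where M = 0]) (auto simp: dual_add dual_scale)
  have "(\<lambda>f\<in>?D. ?O f + 1 * ?O f) = ?O"
    by (rule restrict_ext) simp
  then have \<phi>O: "\<phi> ?O = 0"
    using lin[OF O O, of 1] by (simp only: mult_1_left add_cancel_right_right)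
  have "openin (weak_star_bidual scaleV) {F \<in> bidual scaleV. \<phi> F \<in> ball 0 1}"
    using openin_continuous_map_preimage[OF cont, of "ball 0 1"]
    by (simp add: topspace_weak_star_bidual)
  then obtain S where S: "openin (product_topology (\<lambda>_. euclidean) ?D) S"
    and SB: "{F \<in> bidual scaleV. \<phi> F \<in> ball 0 1} = S \<inter> bidual scaleV"
    unfolding weak_star_bidual_def openin_subtopology by blast
  have "?O \<in> {F \<in> bidual scaleV. \<phi> F \<in> ball 0 1}"
    using O by (simp add: \<phi>O)
  then have "?O \<in> S"
    unfolding SB by (rule IntD1)
  then obtain U where fin: "finite {f \<in> ?D. U f \<noteq> topspace (euclidean :: 'k topology)}"
    and U: "?O \<in> Pi\<^sub>E ?D U" "Pi\<^sub>E ?D U \<subseteq> S"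
    using S unfolding openin_product_topology_alt by blast
  \<comment> \<open>The coordinates that the basic neighbourhood constrains.\<close>
  define J where "J = {f \<in> ?D. U f \<noteq> UNIV}"
  have J: "finite J" "J \<subseteq> ?D"
    using fin by (auto simp: J_def)
  have vanish: "\<phi> F = 0" if F: "F \<in> bidual scaleV" and F0: "\<And>j. j \<in> J \<Longrightarrow> F j = 0" for F
  proof (rule ccontr)
    assume nz: "\<phi> F \<noteq> 0"
    \<comment> \<open>The multiple of \<open>F\<close> at which \<open>\<phi>\<close> takes the value \<open>1\<close> is still in the neighbourhood.\<close>
    let ?G = "\<lambda>f\<in>?D. ?O f + inverse (\<phi> F) * F f"
    have G: "?G \<in> bidual scaleV"
      by (rule bidual_linear_comb[OF O F])
    have "?G \<in> Pi\<^sub>E ?D U"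
    proof (rule PiE_I)
      fix f assume f: "f \<in> ?D"
      show "?G f \<in> U f"
      proof (cases "f \<in> J")
        case True
        then show ?thesis using F0 f PiE_mem[OF U(1) f] by simp
      next
        case False
        then show ?thesis using f by (auto simp: J_def)
      qed
    qed auto
    then have "?G \<in> S \<inter> bidual scaleV"
      using U(2) G by blast
    then have "norm (\<phi> ?G) < 1"
      unfolding SB[symmetric] by simp
    moreover have "\<phi> ?G = 1"
      using lin[OF O F, of "inverse (\<phi> F)"] nz \<phi>O by simp
    ultimately show False by simp
  qed
  have "\<exists>c. \<forall>F\<in>bidual scaleV. \<phi> F = (\<Sum>f\<in>J. c f * F f)"
    by (rule functional_on_finite_kernel[OF J bidual_linear_comb lin vanish])
  then obtain c where c: "\<And>F. F \<in> bidual scaleV \<Longrightarrow> \<phi> F = (\<Sum>f\<in>J. c f * F f)"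
    by blast
  have "\<phi> F = F (\<Sum>f\<in>J. scale_dual (c f) f)" if F: "F \<in> bidual scaleV" for F
    using J(2) by (subst bidual_sum[OF F])
      (auto simp: c[OF F] bidual_scale[OF F] intro!: dual_scale sum.cong)
  moreover have "(\<Sum>f\<in>J. scale_dual (c f) f) \<in> ?D"
    using J(2) by (auto intro!: dual_sum dual_scale)
  ultimately show ?thesis by blast
qed


section \<open>The unit ball of a bidual\<close>

text \<open>
  By Tychonoff's theorem the product of the discs \<open>|F f| \<le> \<parallel>f\<parallel>\<close> is compact; linearity cuts out
  a closed subset, because each instance of it is an equation between continuous functions of
  finitely many coordinates.
\<close>

lemma Banach_Alaoglu_bidual:
  fixes scaleV :: "'k::{real_normed_field, euclidean_space} \<Rightarrow> 'v::real_normed_vector \<Rightarrow> 'v"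
  shows "compactin (weak_star_bidual scaleV)
    {F \<in> bidual scaleV. \<forall>f\<in>dual scaleV. norm (F f) \<le> norm f}" (is "compactin _ ?L")
proof -
  let ?D = "dual scaleV"
  let ?X = "product_topology (\<lambda>_. euclidean) ?D :: (('v \<Rightarrow>\<^sub>L 'k) \<Rightarrow> 'k) topology"
  let ?P = "Pi\<^sub>E ?D (\<lambda>f. cball 0 (norm f)) :: (('v \<Rightarrow>\<^sub>L 'k) \<Rightarrow> 'k) set"
  let ?C = "\<lambda>(f, g, c). {F \<in> topspace ?X. F (f + scale_dual c g) - F f - c * F g \<in> {0}}"
  let ?I = "?D \<times> ?D \<times> (UNIV :: 'k set)"
  have "compactin ?X ?P"
    unfolding compactin_PiE by (intro disjI2 ballI) simp
  moreover have "closedin ?X (\<Inter>i\<in>?I. ?C i)"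
  proof (rule closedin_INT)
    show "?I \<noteq> {}"
      using dual_zero[of scaleV] by auto
    show "closedin ?X (?C i)" if i_in: "i \<in> ?I" for i
    proof -
      obtain f g c where i: "i = (f, g, c)"
        by (cases i)
      then have fg: "f \<in> ?D" "g \<in> ?D"
        using i_in by simp_all
      have "continuous_map ?X euclidean (\<lambda>F. F (f + scale_dual c g) - F f - c * F g)"
        by (intro continuous_map_diff continuous_map_mult_const continuous_map_product_projection
            dual_add dual_scale fg)
      from closedin_continuous_map_preimage[OF this, of "{0}"] show ?thesis
        unfolding i by simp
    qed
  qed
  ultimately have compact: "compactin ?X (?P \<inter> (\<Inter>i\<in>?I. ?C i))"
    by (rule compact_Int_closedin)
  have eq: "?P \<inter> (\<Inter>i\<in>?I. ?C i) = ?L"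
  proof (intro equalityI subsetI)
    fix F assume F: "F \<in> ?P \<inter> (\<Inter>i\<in>?I. ?C i)"
    have bound: "norm (F f) \<le> norm f" if "f \<in> ?D" for f
      using PiE_mem[OF IntD1[OF F] that] by simp
    have lin: "F (f + scale_dual c g) = F f + c * F g" if "f \<in> ?D" "g \<in> ?D" for f g c
    proof -
      have "F \<in> ?C (f, g, c)"
        using that by (intro INT_D[OF IntD2[OF F]]) simp
      then have "F (f + scale_dual c g) - F f - c * F g = 0"
        by simp
      then show ?thesis
        by (simp only: diff_diff_eq right_minus_eq)
    qed
    have "F \<in> extensional ?D"
      using IntD1[OF F] by (simp add: PiE_def)
    then have "F \<in> bidual scaleV"
      by (rule bidualI[where M = 1]) (simp_all only: lin mult_1_left bound)
    with bound show "F \<in> ?L" by simp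
  next
    fix F assume F: "F \<in> ?L"
    then have "F \<in> ?P"
      by (simp add: PiE_iff bidual_extensional)
    moreover have "F \<in> ?C i" if "i \<in> ?I" for i
    proof -
      have F': "F \<in> bidual scaleV"
        using F by simp
      show ?thesis
        using that bidual_extensional[OF F']
        by (cases i) (simp add: PiE_iff bidual_add[OF F'] bidual_scale[OF F'] dual_scale)
    qed
    ultimately show "F \<in> ?P \<inter> (\<Inter>i\<in>?I. ?C i)"
      by (intro IntI INT_I)
  qed
  have "compactin ?X ?L"
    by (rule subst[where P = "compactin ?X", OF eq compact])
  then show ?thesis
    unfolding weak_star_bidual_def compactin_subtopology by (rule conjI) (rule Collect_restrict)
qed

text \<open>
  The map \<open>z \<mapsto> 1 \<bullet> z\<close> takes the place of the real part of a scalar: every real linear functional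
  on \<open>'k\<close> has the form \<open>z \<mapsto> 1 \<bullet> (c * z)\<close>. Indeed \<open>c \<mapsto> (z \<mapsto> 1 \<bullet> (c * z))\<close> is injective, as
  \<open>1 \<bullet> (c * inverse c) = 1\<close>, hence surjective by comparison of dimensions.
\<close>

lemma inner_eq_inner_one_mult:
  fixes w :: "'k::{real_normed_field, euclidean_space}"
  shows "\<exists>c. \<forall>z. w \<bullet> z = 1 \<bullet> (c * z)"
proof -
  define L where "L c = adjoint ((*) c) (1 :: 'k)" for c :: 'k
  have L: "L c \<bullet> z = 1 \<bullet> (c * z)" for c z
  proof -
    have "linear ((*) c)"
      by (rule bounded_linear.linear[OF bounded_linear_mult_right])
    from adjoint_works[OF this, of z 1] have "z \<bullet> L c = (c * z) \<bullet> 1"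
      unfolding L_def .
    then show ?thesis
      unfolding inner_commute[of z] inner_commute[of _ 1] .
  qed
  have "linear L"
  proof (rule linearI)
    show "L (b + c) = L b + L c" for b c
      by (rule vector_eq_rdot[THEN iffD1])
        (simp add: L inner_add_left inner_add_right distrib_right)
    show "L (r *\<^sub>R c) = r *\<^sub>R L c" for r c
      by (rule vector_eq_rdot[THEN iffD1]) (simp add: L)
  qed
  moreover have "c = 0" if "L c = 0" for c
  proof (rule ccontr)
    assume "c \<noteq> 0"
    then show False
      using L[of c "inverse c"] that by simp
  qed
  then have "inj L"
    using linear_injective_0[OF \<open>linear L\<close>] by blast
  ultimately have "surj L"
    by (rule linear_injective_imp_surjective) (rule refl)
  then obtain c where "w = L c"
    by (rule surjE)
  then show ?thesis
    using L by blast
qed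

context normed_space
begin

text \<open>
  The norm of a functional is the supremum of its "real part" on the unit ball, because the
  argument can be multiplied by a scalar of norm \<open>1\<close> that turns the value into a nonnegative
  real number.
\<close>

lemma norm_dual_le:
  assumes g: "g \<in> dual scaleV" and "0 \<le> b"
    and b: "\<And>x. norm x \<le> 1 \<Longrightarrow> 1 \<bullet> g x \<le> b"
  shows "norm g \<le> b"
proof -
  have *: "norm (g x) \<le> b" if x: "norm x \<le> 1" for x
  proof (cases "g x = 0")
    case False
    define u where "u = of_real (norm (g x)) / g x"
    have u: "u * g x = of_real (norm (g x))" and "norm u = 1"
      using False by (simp_all add: u_def norm_divide)
    then have "1 \<bullet> (u * g x) \<le> b"
      using b[of "scaleV u x"] x by (simp add: norm_scale dualD[OF g])
    then show ?thesis
      unfolding u by (simp add: of_real_def dot_square_norm)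
  qed (use \<open>0 \<le> b\<close> in simp)
  show ?thesis
  proof (rule norm_blinfun_bound[OF \<open>0 \<le> b\<close>])
    fix x
    show "norm (g x) \<le> b * norm x"
    proof (cases "x = 0")
      case False
      then show ?thesis
        using *[of "x /\<^sub>R norm x"] by (simp add: blinfun.scaleR_right field_simps)
    qed simp
  qed
qed

text \<open>
  Goldstine's theorem for \<open>F\<close> in the ball of radius \<open>M\<close>, proved without the Hahn-Banach theorem.
  If no \<open>x\<close> in the unit ball is good enough, then the squared distance \<open>Q x\<close> between the vectors
  \<open>(F f)\<^sub>f\<close> and \<open>(M f(x))\<^sub>f\<close>, \<open>f \<in> J\<close>, has a positive infimum \<open>m\<close>. As in the projection onto a
  convex set, the direction \<open>v\<close> at a near minimizer separates the two (\<open>sep\<close>). That separating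
  functional is the "real part" \<open>z \<mapsto> 1 \<bullet> z\<close> of a combination \<open>g\<close> of the \<open>f \<in> J\<close>, and separation
  says that the real part of \<open>F g\<close> exceeds that of \<open>M g(x)\<close> by at least \<open>m / 2\<close> on the whole unit
  ball; this contradicts
  \<open>|F g| \<le> M \<parallel>g\<parallel>\<close>.
\<close>

lemma Goldstine:
  assumes F: "F \<in> bidual scaleV"
    and M: "M > 0" "\<And>f. f \<in> dual scaleV \<Longrightarrow> norm (F f) \<le> M * norm f"
    and J: "finite J" "J \<subseteq> dual scaleV" and "e > 0"
  shows "\<exists>x. norm x \<le> 1 \<and> (\<forall>f\<in>J. norm (F f - M *\<^sub>R f x) < e)"
proof (rule ccontr)
  assume contra: "\<not> ?thesis"
  define Q where "Q x = (\<Sum>f\<in>J. (norm (F f - M *\<^sub>R f x))\<^sup>2)" for x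
  define m where "m = Inf (Q ` cball 0 1)"
  have Qge: "e\<^sup>2 \<le> Q x" if x: "norm x \<le> 1" for x
  proof -
    obtain f where f: "f \<in> J" "e \<le> norm (F f - M *\<^sub>R f x)"
      using contra x by force
    have "e\<^sup>2 \<le> (norm (F f - M *\<^sub>R f x))\<^sup>2"
      using f(2) \<open>e > 0\<close> by (intro power_mono) auto
    also have "\<dots> \<le> Q x"
      unfolding Q_def using J(1) f(1) by (intro member_le_sum) auto
    finally show ?thesis .
  qed
  have ne: "Q ` cball 0 1 \<noteq> {}" by simp
  have bdd: "bdd_below (Q ` cball 0 1)"
    using Qge by (intro bdd_belowI[of _ "e\<^sup>2"]) auto
  have "m \<ge> e\<^sup>2"
    unfolding m_def using ne Qge by (intro cInf_greatest) auto
  then have "m > 0"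
    using \<open>e > 0\<close> by (smt (verit) zero_less_power)
  have mle: "m \<le> Q x" if "norm x \<le> 1" for x
    unfolding m_def using bdd that by (intro cInf_lower) auto
  \<comment> \<open>\<open>C\<close> bounds the squared length of the step between two points of the ball. Moving from \<open>a\<close>
    to \<open>a + t (x - a)\<close> changes \<open>Q\<close> by \<open>- 2 t (v \<bullet> w) + t\<^sup>2 |w|\<^sup>2\<close>, so a minimizer up to \<open>t m / 2\<close>
    satisfies \<open>v \<bullet> w \<le> m / 2\<close> once \<open>t C \<le> m / 2\<close>.\<close>
  define C where "C = (\<Sum>f\<in>J. (2 * M * norm f)\<^sup>2) + 1"
  have "C > 0"
    unfolding C_def by (smt (verit) sum_nonneg zero_le_power2)
  define t where "t = min 1 (m / (2 * C))"
  have t: "0 < t" "t \<le> 1" "t * C \<le> m / 2"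
    using \<open>m > 0\<close> \<open>C > 0\<close> by (auto simp: t_def min_def field_simps)
  have "Inf (Q ` cball 0 1) < m + t * m / 2"
    using t \<open>m > 0\<close> by (simp add: m_def)
  then obtain a where a: "norm a \<le> 1" "Q a < m + t * m / 2"
    using cInf_lessD[OF ne] by fastforce
  define v where "v f = F f - M *\<^sub>R f a" for f :: "'v \<Rightarrow>\<^sub>L 'k"
  have sep: "m / 2 \<le> (\<Sum>f\<in>J. v f \<bullet> (F f - M *\<^sub>R f x))" if x: "norm x \<le> 1" for x
  proof -
    define w where "w f = M *\<^sub>R f (x - a)" for f :: "'v \<Rightarrow>\<^sub>L 'k"
    let ?y = "a + t *\<^sub>R (x - a)"
    have "?y = (1 - t) *\<^sub>R a + t *\<^sub>R x"
      by (simp add: algebra_simps)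
    also have "norm \<dots> \<le> (1 - t) * norm a + t * norm x"
      using t by (smt (verit) norm_triangle_ineq norm_scaleR)
    also have "\<dots> \<le> (1 - t) * 1 + t * 1"
      using t a(1) x by (intro add_mono mult_left_mono) auto
    finally have "m \<le> Q ?y"
      by (intro mle) simp
    also have "Q ?y = (\<Sum>f\<in>J. (norm (v f - t *\<^sub>R w f))\<^sup>2)"
      unfolding Q_def v_def w_def
      by (intro sum.cong refl arg_cong[where f = "\<lambda>z. (norm z)\<^sup>2"])
        (simp add: blinfun.add_right blinfun.scaleR_right blinfun.diff_right algebra_simps)
    also have "\<dots> = (\<Sum>f\<in>J. (norm (v f))\<^sup>2 - 2 * t * (v f \<bullet> w f) + t\<^sup>2 * (norm (w f))\<^sup>2)"
      by (intro sum.cong refl, simp only: power2_norm_eq_inner)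
        (simp add: inner_diff_left inner_diff_right inner_commute algebra_simps power2_eq_square)
    also have "\<dots> = Q a - 2 * t * (\<Sum>f\<in>J. v f \<bullet> w f) + t\<^sup>2 * (\<Sum>f\<in>J. (norm (w f))\<^sup>2)"
      by (simp add: Q_def v_def sum.distrib sum_subtractf sum_distrib_left)
    also have "\<dots> \<le> (m + t * m / 2) - 2 * t * (\<Sum>f\<in>J. v f \<bullet> w f) + t\<^sup>2 * C"
    proof -
      have "(norm (w f))\<^sup>2 \<le> (2 * M * norm f)\<^sup>2" for f
      proof -
        have "norm (f (x - a)) \<le> norm f * norm (x - a)"
          by (rule norm_blinfun)
        also have "\<dots> \<le> norm f * 2"
          using a(1) x norm_triangle_ineq4[of x a] by (intro mult_left_mono) auto
        finally show ?thesis
          using M(1) unfolding w_def by (intro power_mono) auto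
      qed
      then have "(\<Sum>f\<in>J. (norm (w f))\<^sup>2) \<le> C"
        unfolding C_def by (smt (verit) sum_mono)
      then have "t\<^sup>2 * (\<Sum>f\<in>J. (norm (w f))\<^sup>2) \<le> t\<^sup>2 * C"
        by (intro mult_left_mono) auto
      with a(2) show ?thesis by linarith
    qed
    finally have "t * (2 * (\<Sum>f\<in>J. v f \<bullet> w f)) \<le> t * (m / 2 + t * C)"
      by (simp add: power2_eq_square algebra_simps)
    then have "(\<Sum>f\<in>J. v f \<bullet> w f) \<le> m / 2"
      using t by simp
    moreover have "(\<Sum>f\<in>J. v f \<bullet> (F f - M *\<^sub>R f x)) = Q a - (\<Sum>f\<in>J. v f \<bullet> w f)"
      unfolding Q_def sum_subtractf[symmetric]
      by (intro sum.cong refl)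
        (simp add: v_def w_def power2_norm_eq_inner blinfun.diff_right algebra_simps)
    ultimately show ?thesis
      using mle[OF a(1)] by linarith
  qed
  have "\<forall>f. \<exists>c. \<forall>z. v f \<bullet> z = 1 \<bullet> (c * z)"
    using inner_eq_inner_one_mult by blast
  then obtain c where c: "\<And>f z. v f \<bullet> z = 1 \<bullet> (c f * z)"
    by metis
  define g where "g = (\<Sum>f\<in>J. scale_dual (c f) f)"
  have g: "g \<in> dual scaleV"
    unfolding g_def using J(2) by (auto intro!: dual_sum dual_scale)
  have Fg: "F g = (\<Sum>f\<in>J. c f * F f)"
    unfolding g_def using J(2)
    by (subst bidual_sum[OF F]) (auto simp: bidual_scale[OF F] intro!: dual_scale sum.cong)
  have gx: "g x = (\<Sum>f\<in>J. c f * f x)" for x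
    unfolding g_def by (simp add: blinfun.sum_left)
  have bound: "m / 2 + M * (1 \<bullet> g x) \<le> M * norm g" if x: "norm x \<le> 1" for x
  proof -
    have "(\<Sum>f\<in>J. v f \<bullet> (F f - M *\<^sub>R f x)) = 1 \<bullet> (F g - M *\<^sub>R g x)"
      unfolding c Fg gx
      by (simp add: inner_sum_right inner_diff_right sum_subtractf scaleR_sum_right right_diff_distrib)
    then have "m / 2 \<le> 1 \<bullet> F g - M * (1 \<bullet> g x)"
      using sep[OF x] by (simp add: inner_diff_right)
    moreover have "1 \<bullet> F g \<le> M * norm g"
      using norm_cauchy_schwarz[of 1 "F g"] M(2)[OF g] by simp
    ultimately show ?thesis by linarith
  qed
  have "norm g \<le> norm g - m / (2 * M)"
  proof (rule norm_dual_le[OF g])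
    show "0 \<le> norm g - m / (2 * M)"
      using bound[of 0] M(1) by (simp add: field_simps)
    show "1 \<bullet> g x \<le> norm g - m / (2 * M)" if "norm x \<le> 1" for x
      using bound[OF that] M(1) by (simp add: field_simps)
  qed
  moreover have "0 < m / (2 * M)"
    using \<open>m > 0\<close> M(1) by simp
  ultimately show False by linarith
qed

end


section \<open>Gantmacher's theorem for operators into a dual\<close>

locale operator_into_dual = V: normed_space scaleV + W: normed_space scaleW
  for scaleV :: "'k::{real_normed_field, euclidean_space} \<Rightarrow> 'v::real_normed_vector \<Rightarrow> 'v"
    and scaleW :: "'k \<Rightarrow> 'w::real_normed_vector \<Rightarrow> 'w" +
  fixes T :: "'v \<Rightarrow> ('w \<Rightarrow>\<^sub>L 'k)"
  assumes bounded_linear_T: "bounded_linear T"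
    and T_in_dual: "T x \<in> dual scaleW"
    and T_scale: "T (scaleV c x) = scale_dual c (T x)"
begin

definition adj :: "(('w \<Rightarrow>\<^sub>L 'k) \<Rightarrow> 'k) \<Rightarrow> ('v \<Rightarrow>\<^sub>L 'k)"
  where "adj G = Blinfun (\<lambda>x. G (T x))"

lemma adj_apply:
  assumes G: "G \<in> bidual scaleW"
  shows "adj G x = G (T x)"
proof -
  interpret T: bounded_linear T by (rule bounded_linear_T)
  obtain M where M: "M > 0" "\<And>f. f \<in> dual scaleW \<Longrightarrow> norm (G f) \<le> M * norm f"
    using bidual_bound[OF G] by blast
  obtain K where K: "\<And>x. norm (T x) \<le> norm x * K"
    using T.bounded by blast
  have "bounded_linear (\<lambda>x. G (T x))"
  proof (rule bounded_linear_intro)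
    fix x
    have "norm (G (T x)) \<le> M * norm (T x)"
      by (rule M(2)[OF T_in_dual])
    also have "\<dots> \<le> M * (norm x * K)"
      using M(1) K by (intro mult_left_mono) auto
    finally show "norm (G (T x)) \<le> norm x * (M * K)"
      by (simp add: algebra_simps)
  qed (simp_all add: T.add T.scaleR bidual_add[OF G] bidual_scaleR[OF G] T_in_dual)
  then show ?thesis
    unfolding adj_def by (simp add: bounded_linear_Blinfun_apply)
qed

lemma adj_in_dual: "G \<in> bidual scaleW \<Longrightarrow> adj G \<in> dual scaleV"
  unfolding dual_def by (simp add: adj_apply T_scale bidual_scale T_in_dual)

lemma adj_linear_comb:
  assumes "G \<in> bidual scaleW" "H \<in> bidual scaleW"
  shows "adj (\<lambda>f\<in>dual scaleW. G f + c * H f) = adj G + scale_dual c (adj H)"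
  by (rule blinfun_eqI)
    (simp add: adj_apply assms bidual_linear_comb T_in_dual blinfun.add_left)

text \<open>
  If the image of the unit ball lies in a weakly compact \<open>K\<close>, take \<open>F \<in> V\<^sup>*\<^sup>*\<close> of norm at most
  \<open>M\<close>. By Goldstine's theorem, finitely many of the conditions \<open>|F (adj G) - M * G k| \<le> e\<close> have
  a common solution \<open>k = T x \<in> K\<close>; by compactness all of them do, so \<open>G \<mapsto> F (adj G)\<close> is \<open>M\<close> times
  an evaluation. Conversely, if all these functionals are evaluations at points \<open>S F \<in> W\<^sup>*\<close>, then \<open>S\<close>
  is continuous from the weak* to the weak topology and extends \<open>T\<close>. It maps the weak*
  compact unit ball of \<open>V\<^sup>*\<^sup>*\<close> onto a weakly compact set containing the image of the ball of \<open>V\<close>.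
\<close>

theorem Gantmacher:
  "relatively_compactin (weak_dual scaleW) {T x | x. norm x \<le> 1} \<longleftrightarrow>
   (\<forall>F\<in>bidual scaleV. continuous_map (weak_star_bidual scaleW) euclidean (\<lambda>G. F (adj G)))"
    (is "?compact \<longleftrightarrow> ?cont")
proof
  assume ?compact
  define K where "K = weak_dual scaleW closure_of {T x | x. norm x \<le> 1}"
  have K: "compactin (weak_dual scaleW) K"
    using \<open>?compact\<close> by (simp add: relatively_compactin_def K_def)
  have "{T x | x. norm x \<le> 1} \<subseteq> K"
    unfolding K_def by (rule closure_of_subset) (auto simp: topspace_weak_dual T_in_dual)
  then have TK: "T x \<in> K" if "norm x \<le> 1" for x
    using that by blast
  show ?cont
  proof
    fix F assume F: "F \<in> bidual scaleV"
    obtain M where M: "M > 0" "\<And>f. f \<in> dual scaleV \<Longrightarrow> norm (F f) \<le> M * norm f"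
      using bidual_bound[OF F] by blast
    define C where "C = (\<lambda>(G, e). {k \<in> dual scaleW. F (adj G) - of_real M * G k \<in> cball 0 e})"
    let ?I = "bidual scaleW \<times> {0 :: real<..}"
    have closed: "closedin (weak_dual scaleW) (C i)" if i_in: "i \<in> ?I" for i
    proof -
      obtain G e where i: "i = (G, e)" "G \<in> bidual scaleW"
        using i_in by auto
      have "continuous_map (weak_dual scaleW) euclidean (\<lambda>k. F (adj G) - of_real M * G k)"
        by (rule continuous_map_diff[OF _ continuous_map_mult_const[OF
                continuous_map_weak_functional[OF i(2)]]]) simp
      from closedin_continuous_map_preimage[OF this, of "cball 0 e"] show ?thesis
        by (simp add: C_def i topspace_weak_dual)
    qed
    have meet: "K \<inter> \<Inter> \<F> \<noteq> {}" if \<F>: "finite \<F>" "\<F> \<subseteq> C ` ?I" for \<F>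
    proof -
      obtain I where I: "finite I" "I \<subseteq> ?I" "\<F> = C ` I"
        using finite_subset_image[OF \<F>] by blast
      define e where "e = Min (insert 1 (snd ` I))"
      have e: "e > 0" "\<And>G r. (G, r) \<in> I \<Longrightarrow> e \<le> r"
        using I by (auto simp: e_def intro!: Min_le rev_image_eqI)
      obtain x where x: "norm x \<le> 1"
        "\<And>f. f \<in> (adj \<circ> fst) ` I \<Longrightarrow> norm (F f - M *\<^sub>R f x) < e"
        using V.Goldstine[OF F M, of "(adj \<circ> fst) ` I" e] I e(1) adj_in_dual by fastforce
      have "T x \<in> C i" if "i \<in> I" for i
      proof -
        obtain G r where i: "i = (G, r)" "G \<in> bidual scaleW"
          using \<open>i \<in> I\<close> I(2) by auto
        have "norm (F (adj G) - M *\<^sub>R adj G x) < e"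
          using x(2)[of "adj G"] \<open>i \<in> I\<close> i(1) by force
        then show ?thesis
          using e(2)[of G r] \<open>i \<in> I\<close> i
          by (auto simp: C_def T_in_dual adj_apply scaleR_conv_of_real)
      qed
      then show ?thesis
        using TK[OF x(1)] I(3) by blast
    qed
    have "K \<inter> \<Inter> (C ` ?I) \<noteq> {}"
    proof (rule K[unfolded compactin_fip, THEN conjunct2, rule_format], intro conjI ballI allI impI)
      show "closedin (weak_dual scaleW) D" if "D \<in> C ` ?I" for D
        using closed that by (elim imageE) simp
    qed (use meet in blast)
    then obtain k where "k \<in> K" and kC: "\<And>i. i \<in> ?I \<Longrightarrow> k \<in> C i"
      by blast
    have "k \<in> dual scaleW"
      using compactin_subset_topspace[OF K] \<open>k \<in> K\<close> by (auto simp: topspace_weak_dual)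
    have "F (adj G) = of_real M * G k" if "G \<in> bidual scaleW" for G
    proof -
      have "norm (F (adj G) - of_real M * G k) \<le> 0 + e" if "e > 0" for e
        using kC[of "(G, e)"] \<open>G \<in> bidual scaleW\<close> that by (auto simp: C_def)
      then show ?thesis
        using field_le_epsilon by (metis eq_iff_diff_eq_0 norm_le_zero_iff)
    qed
    then show "continuous_map (weak_star_bidual scaleW) euclidean (\<lambda>G. F (adj G))"
      by (intro continuous_map_eq[OF continuous_map_mult_const[OF
              continuous_map_weak_star_evaluation[OF \<open>k \<in> dual scaleW\<close>], of "of_real M"]])
        (simp add: topspace_weak_star_bidual)
  qed
next
  assume ?cont
  have "\<exists>g\<in>dual scaleW. \<forall>G\<in>bidual scaleW. F (adj G) = G g" if F: "F \<in> bidual scaleV" for F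
    using \<open>?cont\<close> F
    by (intro weak_star_continuous_imp_evaluation)
      (auto simp: adj_linear_comb bidual_add[OF F] bidual_scale[OF F] adj_in_dual dual_scale)
  then obtain S where S: "\<And>F. F \<in> bidual scaleV \<Longrightarrow> S F \<in> dual scaleW"
    "\<And>F G. F \<in> bidual scaleV \<Longrightarrow> G \<in> bidual scaleW \<Longrightarrow> F (adj G) = G (S F)"
    by metis
  have S_cont: "continuous_map (weak_star_bidual scaleV) (weak_dual scaleW) S"
    unfolding weak_dual_def
  proof (rule continuous_on_generated_topo)
    fix O' assume "O' \<in> {{f \<in> dual scaleW. G f \<in> U} | G U. G \<in> bidual scaleW \<and> open U}"
    then obtain G U where O': "O' = {f \<in> dual scaleW. G f \<in> U}" "G \<in> bidual scaleW" "open U"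
      by blast
    have "S -` O' \<inter> topspace (weak_star_bidual scaleV) = {F \<in> bidual scaleV. F (adj G) \<in> U}"
      by (auto simp: topspace_weak_star_bidual O'(1) S(1) S(2)[OF _ O'(2)])
    then show "openin (weak_star_bidual scaleV) (S -` O' \<inter> topspace (weak_star_bidual scaleV))"
      using openin_continuous_map_preimage[OF
          continuous_map_weak_star_evaluation[OF adj_in_dual[OF O'(2)]], of U] O'(3)
      by (simp add: topspace_weak_star_bidual)
  next
    show "S ` topspace (weak_star_bidual scaleV)
      \<subseteq> \<Union> {{f \<in> dual scaleW. G f \<in> U} | G U. G \<in> bidual scaleW \<and> open U}"
      using S(1) topspace_weak_dual[of scaleW]
      unfolding weak_dual_def topology_generated_by_topspace topspace_weak_star_bidual by blast
  qed
  let ?K = "S ` {F \<in> bidual scaleV. \<forall>f\<in>dual scaleV. norm (F f) \<le> norm f}"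
  have K: "compactin (weak_dual scaleW) ?K"
    by (rule image_compactin[OF Banach_Alaoglu_bidual S_cont])
  have TK: "{T x | x. norm x \<le> 1} \<subseteq> ?K"
  proof clarify
    fix x :: 'v assume x: "norm x \<le> 1"
    let ?x = "\<lambda>f\<in>dual scaleV. blinfun_apply f x"
    have ball: "?x \<in> {F \<in> bidual scaleV. \<forall>f\<in>dual scaleV. norm (F f) \<le> norm f}"
    proof -
      have "norm (blinfun_apply f x) \<le> norm f" for f :: "'v \<Rightarrow>\<^sub>L 'k"
        by (rule order_trans[OF norm_blinfun mult_left_le]) (use x in auto)
      then show ?thesis
        by (simp add: bidual_evaluation)
    qed
    have "S ?x = T x"
    proof (rule blinfun_eqI)
      fix y
      let ?y = "\<lambda>f\<in>dual scaleW. blinfun_apply f y"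
      have y: "?y \<in> bidual scaleW"
        by (rule bidual_evaluation)
      have "blinfun_apply (S ?x) y = ?y (S ?x)"
        using S(1) ball by simp
      also have "\<dots> = ?x (adj ?y)"
        using S(2)[OF _ y] ball by simp
      also have "\<dots> = T x y"
        by (simp add: adj_in_dual[OF y] adj_apply[OF y] T_in_dual)
      finally show "blinfun_apply (S ?x) y = T x y" .
    qed
    then show "T x \<in> ?K"
      by (rule subst) (rule imageI[OF ball])
  qed
  have "closedin (weak_dual scaleW) ?K"
    by (rule compactin_imp_closedin[OF Hausdorff_weak_dual K])
  then have "weak_dual scaleW closure_of {T x | x. norm x \<le> 1} \<subseteq> ?K"
    by (rule closure_of_minimal[OF TK])
  then show ?compact
    unfolding relatively_compactin_def
    by (auto simp: topspace_weak_dual T_in_dual intro: closed_compactin[OF K])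
qed

end


section \<open>Module actions\<close>

lemma adj1_apply:
  assumes "bounded_bilinear m"
  shows "adj1 m f x y = f (m x y)"
proof -
  have "bounded_linear (\<lambda>y. blinfun_apply f (m x y))"
    by (rule bounded_linear_compose[OF blinfun.bounded_linear_right
          bounded_bilinear.bounded_linear_right[OF assms]])
  then show ?thesis
    by (simp add: adj1_def bounded_linear_Blinfun_apply)
qed

context left_banach_module
begin

lemma act_adj1_apply: "adj1 act f a b = f (act a b)"
  by (rule adj1_apply[OF bounded_bilinear_act])

lemma mult_adj1_apply: "adj1 (*) f a c = f (a * c :: 'a)"
  by (rule adj1_apply[OF bounded_bilinear_mult])

lemma mult_adj1_in_dual: "f \<in> dual scaleA \<Longrightarrow> adj1 (*) f a \<in> dual scaleA"
  by (simp add: dual_def mult_adj1_apply A.mult_scale_right)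

lemma operator_into_dual_adj1:
  assumes f: "f \<in> dual scaleB"
  shows "operator_into_dual scaleA scaleB (adj1 act f)"
proof
  interpret act: bounded_bilinear act by (rule bounded_bilinear_act)
  obtain K where K: "K > 0" "\<And>a b. norm (act a b) \<le> norm a * norm b * K"
    using act.pos_bounded by blast
  show "\<exists>C. \<forall>a. norm (adj1 act f a) \<le> norm a * C"
  proof (intro exI allI)
    fix a
    have "norm (adj1 act f a b) \<le> norm a * (K * norm f) * norm b" for b
    proof -
      have "norm (f (act a b)) \<le> norm f * norm (act a b)"
        by (rule norm_blinfun)
      also have "\<dots> \<le> norm f * (norm a * norm b * K)"
        by (intro mult_left_mono K(2)) simp
      finally show ?thesis
        by (simp add: act_adj1_apply algebra_simps)
    qed
    then show "norm (adj1 act f a) \<le> norm a * (K * norm f)"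
      using K(1) by (intro norm_blinfun_bound) auto
  qed
qed (use f in \<open>auto intro!: blinfun_eqI simp: act_adj1_apply dual_def act_scale_left act_scale_right
      bounded_bilinear.add_left[OF bounded_bilinear_act] blinfun.add_left blinfun.add_right
      bounded_bilinear.scaleR_left[OF bounded_bilinear_act] blinfun.scaleR_left blinfun.scaleR_right\<close>)

lemma adj2_eq_adj:
  "f \<in> dual scaleB \<Longrightarrow> adj2 act G f = operator_into_dual.adj (adj1 act f) G"
  by (simp add: adj2_def operator_into_dual.adj_def[OF operator_into_dual_adj1])

lemma adj2_apply: "f \<in> dual scaleB \<Longrightarrow> G \<in> bidual scaleB \<Longrightarrow> adj2 act G f a = G (adj1 act f a)"
  by (simp add: adj2_eq_adj operator_into_dual.adj_apply[OF operator_into_dual_adj1])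

lemma adj2_in_dual: "f \<in> dual scaleB \<Longrightarrow> G \<in> bidual scaleB \<Longrightarrow> adj2 act G f \<in> dual scaleA"
  by (simp add: adj2_eq_adj operator_into_dual.adj_in_dual[OF operator_into_dual_adj1])

lemma adj1_in_dual: "f \<in> dual scaleB \<Longrightarrow> adj1 act f a \<in> dual scaleB"
  by (rule operator_into_dual.T_in_dual[OF operator_into_dual_adj1])

text \<open>
  The target of the maps in the definition of the centre is the bidual with its subspace topology,
  so continuity there requires that the values do lie in the bidual.
\<close>

lemma adj3_in_bidual:
  assumes F: "F \<in> bidual scaleA" and G: "G \<in> bidual scaleB"
  shows "adj3 scaleB act F G \<in> bidual scaleB"
proof -
  obtain M where M: "M > 0" "\<And>f. f \<in> dual scaleA \<Longrightarrow> norm (F f) \<le> M * norm f"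
    using bidual_bound[OF F] by blast
  obtain N where N: "N > 0" "\<And>f. f \<in> dual scaleB \<Longrightarrow> norm (G f) \<le> N * norm f"
    using bidual_bound[OF G] by blast
  obtain K where K: "K > 0" "\<And>a b. norm (act a b) \<le> norm a * norm b * K"
    using bounded_bilinear.pos_bounded[OF bounded_bilinear_act] by blast
  show ?thesis
  proof (rule bidualI[where M = "M * (N * K)"])
    fix f g c assume fg: "f \<in> dual scaleB" "g \<in> dual scaleB"
    have "adj1 act (f + scale_dual c g) a = adj1 act f a + scale_dual c (adj1 act g a)" for a
      by (rule blinfun_eqI) (simp add: act_adj1_apply blinfun.add_left)
    then have "adj2 act G (f + scale_dual c g) = adj2 act G f + scale_dual c (adj2 act G g)"
      using fg
      by (intro blinfun_eqI) (simp add: adj2_apply G dual_add dual_scale blinfun.add_left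
          bidual_add[OF G] bidual_scale[OF G] adj1_in_dual)
    then show "adj3 scaleB act F G (f + scale_dual c g) =
        adj3 scaleB act F G f + c * adj3 scaleB act F G g"
      using fg by (simp add: adj3_def dual_add dual_scale bidual_add[OF F] bidual_scale[OF F]
          adj2_in_dual G)
  next
    fix f assume f: "f \<in> dual scaleB"
    have adj1_bound: "norm (adj1 act f a) \<le> K * norm a * norm f" for a
    proof (rule norm_blinfun_bound)
      fix b
      have "norm (f (act a b)) \<le> norm f * norm (act a b)"
        by (rule norm_blinfun)
      also have "\<dots> \<le> norm f * (norm a * norm b * K)"
        by (intro mult_left_mono K(2)) simp
      finally show "norm (adj1 act f a b) \<le> K * norm a * norm f * norm b"
        by (simp add: act_adj1_apply algebra_simps)
    qed (use K(1) in simp)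
    have "norm (adj2 act G f) \<le> N * K * norm f"
    proof (rule norm_blinfun_bound)
      fix a
      have "norm (adj2 act G f a) \<le> N * norm (adj1 act f a)"
        using N(2)[OF adj1_in_dual[OF f]] by (simp add: adj2_apply f G)
      also have "\<dots> \<le> N * (K * norm a * norm f)"
        using N(1) by (intro mult_left_mono adj1_bound) simp
      finally show "norm (adj2 act G f a) \<le> N * K * norm f * norm a"
        by (simp add: algebra_simps)
    qed (use N(1) K(1) in simp)
    then have "M * norm (adj2 act G f) \<le> M * (N * K * norm f)"
      using M(1) by (intro mult_left_mono) auto
    then show "norm (adj3 scaleB act F G f) \<le> M * (N * K) * norm f"
      using M(2)[OF adj2_in_dual[OF f G]] f by (simp add: adj3_def algebra_simps)
  qed (simp add: adj3_def)
qed

lemma top_center_iff: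
  "F \<in> top_center scaleA scaleB act \<longleftrightarrow> F \<in> bidual scaleA \<and>
    (\<forall>f\<in>dual scaleB. continuous_map (weak_star_bidual scaleB) euclidean (\<lambda>G. F (adj2 act G f)))"
proof (cases "F \<in> bidual scaleA")
  case True
  have "continuous_map (weak_star_bidual scaleB) (weak_star_bidual scaleB) (adj3 scaleB act F) \<longleftrightarrow>
    continuous_map (weak_star_bidual scaleB) (product_topology (\<lambda>_. euclidean) (dual scaleB))
      (adj3 scaleB act F)"
    by (subst (2) weak_star_bidual_def)
      (auto simp: continuous_map_in_subtopology topspace_weak_star_bidual adj3_in_bidual True)
  also have "\<dots> \<longleftrightarrow> (\<forall>f\<in>dual scaleB.
      continuous_map (weak_star_bidual scaleB) euclidean (\<lambda>G. F (adj2 act G f)))"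
    unfolding continuous_map_componentwise by (auto simp: adj3_def)
  finally show ?thesis
    using True by (simp add: top_center_def)
qed (simp add: top_center_def)

text \<open>
  Evaluated at \<open>c\<close>, both sides are \<open>G\<close> applied to \<open>f(ac) = (fa)c\<close>.
\<close>

lemma adj1_adj2:
  assumes "f \<in> dual scaleB" "G \<in> bidual scaleB"
  shows "adj1 (*) (adj2 act G f) a = adj2 act G (adj1 act f a)"
proof (rule blinfun_eqI)
  fix c
  have "adj1 act f (a * c) = adj1 act (adj1 act f a) c"
    by (rule blinfun_eqI) (simp add: act_adj1_apply act_mult)
  then show "adj1 (*) (adj2 act G f) a c = adj2 act G (adj1 act f a) c"
    using assms by (simp add: mult_adj1_apply adj2_apply adj1_in_dual)
qed

lemma left_mult_in_bidual:
  assumes F: "F \<in> bidual scaleA"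
  shows "left_mult scaleA a F \<in> bidual scaleA"
proof -
  obtain M where M: "M > 0" "\<And>f. f \<in> dual scaleA \<Longrightarrow> norm (F f) \<le> M * norm f"
    using bidual_bound[OF F] by blast
  show ?thesis
  proof (rule bidualI[where M = "M * norm a"])
    fix f g c assume fg: "f \<in> dual scaleA" "g \<in> dual scaleA"
    have "adj1 (*) (f + scale_dual c g) a = adj1 (*) f a + scale_dual c (adj1 (*) g a)"
      by (rule blinfun_eqI) (simp add: mult_adj1_apply blinfun.add_left)
    then show "left_mult scaleA a F (f + scale_dual c g) =
        left_mult scaleA a F f + c * left_mult scaleA a F g"
      using fg by (simp add: left_mult_def dual_add dual_scale bidual_add[OF F] bidual_scale[OF F]
          mult_adj1_in_dual)
  next
    fix f assume f: "f \<in> dual scaleA"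
    have "norm (adj1 (*) f a) \<le> norm a * norm f"
    proof (rule norm_blinfun_bound)
      fix c
      have "norm (f (a * c)) \<le> norm f * norm (a * c)"
        by (rule norm_blinfun)
      also have "\<dots> \<le> norm f * (norm a * norm c)"
        by (intro mult_left_mono norm_mult_ineq) simp
      finally show "norm (adj1 (*) f a c) \<le> norm a * norm f * norm c"
        by (simp add: mult_adj1_apply algebra_simps)
    qed simp
    then have "M * norm (adj1 (*) f a) \<le> M * (norm a * norm f)"
      using M(1) by (intro mult_left_mono) auto
    then show "norm (left_mult scaleA a F f) \<le> M * norm a * norm f"
      using M(2)[OF mult_adj1_in_dual[OF f], of a] f by (simp add: left_mult_def algebra_simps)
  qed (simp add: left_mult_def)
qed

text \<open>
  Here \<open>F\<close> may be an element of \<open>A\<^sup>*\<^sup>*\<close> or of \<open>(A\<^sup>*A)\<^sup>*\<close>, since only \<open>aF\<close> is assumed to be in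
  \<open>A\<^sup>*\<^sup>*\<close>; this lets the lemma serve all the implications.
\<close>

lemma left_mult_in_top_center_iff:
  assumes "left_mult scaleA a F \<in> bidual scaleA"
  shows "left_mult scaleA a F \<in> top_center scaleA scaleB act \<longleftrightarrow>
    (\<forall>f\<in>dual scaleB. continuous_map (weak_star_bidual scaleB) euclidean
      (\<lambda>G. F (adj2 act G (adj1 act f a))))"
proof -
  have "left_mult scaleA a F (adj2 act G f) = F (adj2 act G (adj1 act f a))"
    if "f \<in> dual scaleB" "G \<in> topspace (weak_star_bidual scaleB)" for f G
    using that by (simp add: topspace_weak_star_bidual left_mult_def adj2_in_dual adj1_adj2)
  then have "continuous_map (weak_star_bidual scaleB) euclidean (\<lambda>G. left_mult scaleA a F (adj2 act G f))
    \<longleftrightarrow> continuous_map (weak_star_bidual scaleB) euclidean (\<lambda>G. F (adj2 act G (adj1 act f a)))"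
    if "f \<in> dual scaleB" for f
    using that continuous_map_eq by (metis (no_types, lifting))
  then show ?thesis
    using assms by (simp add: top_center_iff)
qed

lemma wap_l_iff:
  assumes f: "f \<in> dual scaleB"
  shows "f \<in> wap_l scaleB act \<longleftrightarrow> (\<forall>F\<in>bidual scaleA.
    continuous_map (weak_star_bidual scaleB) euclidean (\<lambda>G. F (adj2 act G f)))"
  using operator_into_dual.Gantmacher[OF operator_into_dual_adj1[OF f]] f
  by (simp add: wap_l_def adj2_eq_adj)

lemma dual_times_subset_wap_l_iff:
  "dual_times scaleB act \<subseteq> wap_l scaleB act \<longleftrightarrow>
    left_mult_set scaleA (bidual scaleA) \<subseteq> top_center scaleA scaleB act"
proof -
  have "dual_times scaleB act \<subseteq> wap_l scaleB act \<longleftrightarrow>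
    (\<forall>f\<in>dual scaleB. \<forall>a. adj1 act f a \<in> wap_l scaleB act)"
    by (auto simp: dual_times_def subset_eq)
  also have "\<dots> \<longleftrightarrow> (\<forall>f\<in>dual scaleB. \<forall>a. \<forall>F\<in>bidual scaleA. continuous_map (weak_star_bidual scaleB) euclidean
      (\<lambda>G. F (adj2 act G (adj1 act f a))))"
    by (simp add: wap_l_iff adj1_in_dual)
  also have "\<dots> \<longleftrightarrow> (\<forall>a. \<forall>F\<in>bidual scaleA. left_mult scaleA a F \<in> top_center scaleA scaleB act)"
    using left_mult_in_top_center_iff[OF left_mult_in_bidual] by auto
  also have "\<dots> \<longleftrightarrow> left_mult_set scaleA (bidual scaleA) \<subseteq> top_center scaleA scaleB act"
    by (auto simp: left_mult_set_def)
  finally show ?thesis .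
qed

lemma left_mult_top_center_AstarA:
  assumes "H \<in> top_center_AstarA scaleA scaleB act" "left_mult scaleA a H \<in> bidual scaleA"
  shows "left_mult scaleA a H \<in> top_center scaleA scaleB act"
  using assms left_mult_in_top_center_iff[OF assms(2)]
  by (auto simp: top_center_AstarA_def dual_times_def)

end

theorem mainTheorem3:
  fixes scaleA :: "'k::{real_normed_field, euclidean_space} \<Rightarrow> 'a::{real_normed_algebra, banach} \<Rightarrow> 'a"
    and scaleB :: "'k \<Rightarrow> 'b::banach \<Rightarrow> 'b"
    and act :: "'a \<Rightarrow> 'b \<Rightarrow> 'b"
  assumes "banach_algebra scaleA"
    and "left_banach_module scaleA scaleB act"
  shows "(dual_times scaleB act \<subseteq> wap_l scaleB act \<longleftrightarrow>
           left_mult_set scaleA (bidual scaleA) \<subseteq> top_center scaleA scaleB act) \<and>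
         (left_mult_set scaleA (bidual scaleA) \<subseteq>
             left_mult_set scaleA (top_center_AstarA scaleA scaleB act) \<longrightarrow>
           left_mult_set scaleA (bidual scaleA) \<subseteq> top_center scaleA scaleB act)"
proof (intro conjI impI subsetI)
  interpret left_banach_module scaleA scaleB act by (rule assms(2))
  show "dual_times scaleB act \<subseteq> wap_l scaleB act \<longleftrightarrow>
      left_mult_set scaleA (bidual scaleA) \<subseteq> top_center scaleA scaleB act"
    by (rule dual_times_subset_wap_l_iff)
  fix F
  assume sub: "left_mult_set scaleA (bidual scaleA) \<subseteq>
      left_mult_set scaleA (top_center_AstarA scaleA scaleB act)"
    and F: "F \<in> left_mult_set scaleA (bidual scaleA)"
  from F have "F \<in> bidual scaleA"
    by (auto simp: left_mult_set_def left_mult_in_bidual)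
  moreover obtain a H where "F = left_mult scaleA a H" "H \<in> top_center_AstarA scaleA scaleB act"
    using subsetD[OF sub F] by (auto simp: left_mult_set_def)
  ultimately show "F \<in> top_center scaleA scaleB act"
    by (simp add: left_mult_top_center_AstarA)
qed

end
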